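(* Let the cyclic group $\mathbb Z_q$ act on $(\mathcal X,\mathcal B,\mu)$ by automorphisms $F_s$, $s\in\mathbb Z_q$ (so $F_{s'}\circ F_{s''}=F_{s'+s''}$ and $F_{-s}=F_s^{-1}$), and assume the action is almost free: there is $X\in\mathcal B$ such that the sets $F_s(X)$, $s\in\mathbb Z_q$, are pairwise disjoint and $\mu(\mathcal X\setminus\bigcup_{s}F_s(X))=0$. Put $r=e^{2\pi i/q}$, $U_sf=f\circ F_s$, and for $n\in\mathbb Z_q$ $$H_n=\{f\in\mathcal H: U_sf=r^{ns}f\ \text{ for all } s\in\mathbb Z_q\}.$$ Then the spaces $H_n$, $n\in\mathbb Z_q$, are pairwise orthogonal, $\mathcal H=\bigoplus_{n\in\mathbb Z_q}H_n$, and $\dim_\mu(H_n)=1/q$ for every $n\in\mathbb Z_q$.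
   Context: $(\mathcal X,\mathcal B,\mu)$ is a probability measure space and $\mathcal H=L^2(\mathcal X,\mu)$ (complex-valued). An automorphism of $(\mathcal X,\mathcal B,\mu)$ is an invertible map $F:\mathcal X\to\mathcal X$ with $F,F^{-1}$ measurable and $\mu(F^{-1}(X))=\mu(X)$ for all $X\in\mathcal B$. For $X\in\mathcal B$, $\pi_X:\mathcal H\to\mathcal H$ is the orthogonal projector $\pi_Xf=\mathbf 1_X f$. A partition is a finite family $\chi=\{Y_1,\dots,Y_J\}\subset\mathcal B$ with $\mu(\mathcal X\setminus\bigcup_j Y_j)=0$ and $\mu(Y_j\cap Y_k)=0$ for $j\ne k$. For a bounded operator $W$ on $\mathcal H$ with operator norm $\|W\|$, put $\mathcal M_\chi(W)=\sum_{j=1}^J\mu(Y_j)\|W\pi_{Y_j}\|^2$, and define the $\mu$-norm $\|W\|_\mu=\inf_\chi\sqrt{\mathcal M_\chi(W)}$, the infimum being over all partitions $\chi$. For a closed subspace $H\subset\mathcal H$ with orthogonal projector $\pi_H$ onto $H$ (regarded as an operator on $\mathcal H$), $\dim_\mu(H)=\|\pi_H\|_\mu^2$. *)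

theory Defs
  imports "HOL-Probability.Probability" "HOL-Algebra.Elementary_Groups"
begin

text \<open>
  The space \<open>L\<^sup>2(M)\<close> is handled through representatives: its elements are square-integrable
  functions, and equality in the Hilbert space is \<open>aeq M\<close>, equality almost everywhere.
\<close>

definition l2_space :: "'a measure \<Rightarrow> ('a \<Rightarrow> complex) set" where
  "l2_space M = {f \<in> borel_measurable M. integrable M (\<lambda>x. (cmod (f x))\<^sup>2)}"

definition aeq :: "'a measure \<Rightarrow> ('a \<Rightarrow> complex) \<Rightarrow> ('a \<Rightarrow> complex) \<Rightarrow> bool" where
  "aeq M f g \<longleftrightarrow> (AE x in M. f x = g x)"

definition l2_inner :: "'a measure \<Rightarrow> ('a \<Rightarrow> complex) \<Rightarrow> ('a \<Rightarrow> complex) \<Rightarrow> complex" where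
  "l2_inner M f g = (\<integral>x. f x * cnj (g x) \<partial>M)"

definition l2_norm :: "'a measure \<Rightarrow> ('a \<Rightarrow> complex) \<Rightarrow> real" where
  "l2_norm M f = sqrt (\<integral>x. (cmod (f x))\<^sup>2 \<partial>M)"

text \<open>
  Closedness is sequential closedness in norm; it includes saturation under \<open>aeq M\<close>
  (take a constant sequence).
\<close>

definition closed_l2_subspace :: "'a measure \<Rightarrow> ('a \<Rightarrow> complex) set \<Rightarrow> bool" where
  "closed_l2_subspace M H \<longleftrightarrow>
     H \<subseteq> l2_space M \<and>
     (\<lambda>x. 0) \<in> H \<and>
     (\<forall>f\<in>H. \<forall>g\<in>H. (\<lambda>x. f x + g x) \<in> H) \<and>
     (\<forall>c. \<forall>f\<in>H. (\<lambda>x. c * f x) \<in> H) \<and>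
     (\<forall>u. \<forall>f\<in>l2_space M. (\<forall>k::nat. u k \<in> H) \<longrightarrow>
        (\<lambda>k. l2_norm M (\<lambda>x. u k x - f x)) \<longlonglongrightarrow> 0 \<longrightarrow> f \<in> H)"

definition l2_orthogonal ::
    "'a measure \<Rightarrow> ('a \<Rightarrow> complex) set \<Rightarrow> ('a \<Rightarrow> complex) set \<Rightarrow> bool" where
  "l2_orthogonal M H K \<longleftrightarrow> (\<forall>f\<in>H. \<forall>g\<in>K. l2_inner M f g = 0)"

text \<open>
  Internal direct sum of finitely many closed subspaces: every element of \<open>L\<^sup>2(M)\<close> has
  exactly one decomposition, up to equality almost everywhere.
\<close>

definition l2_direct_sum ::
    "'a measure \<Rightarrow> 'i set \<Rightarrow> ('i \<Rightarrow> ('a \<Rightarrow> complex) set) \<Rightarrow> bool" where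
  "l2_direct_sum M I H \<longleftrightarrow>
     (\<forall>n\<in>I. closed_l2_subspace M (H n)) \<and>
     (\<forall>f\<in>l2_space M. \<exists>g. (\<forall>n\<in>I. g n \<in> H n) \<and> aeq M f (\<lambda>x. \<Sum>n\<in>I. g n x) \<and>
        (\<forall>g'. (\<forall>n\<in>I. g' n \<in> H n) \<and> aeq M f (\<lambda>x. \<Sum>n\<in>I. g' n x) \<longrightarrow>
           (\<forall>n\<in>I. aeq M (g' n) (g n))))"

text \<open>
  Operators on \<open>L\<^sup>2(M)\<close> are functions on representatives. The real supremum below is the
  operator norm for bounded linear operators only; it carries no meaning for others.
\<close>

definition l2_opnorm :: "'a measure \<Rightarrow> (('a \<Rightarrow> complex) \<Rightarrow> ('a \<Rightarrow> complex)) \<Rightarrow> real" where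
  "l2_opnorm M W = Sup {l2_norm M (W f) | f. f \<in> l2_space M \<and> l2_norm M f \<le> 1}"

definition proj_set :: "'a set \<Rightarrow> ('a \<Rightarrow> complex) \<Rightarrow> ('a \<Rightarrow> complex)" where
  "proj_set X f = (\<lambda>x. indicator X x * f x)"

text \<open>
  For a closed subspace \<open>H\<close> the function chosen here exists and is unique up to \<open>aeq M\<close>.
\<close>

definition proj_subspace ::
    "'a measure \<Rightarrow> ('a \<Rightarrow> complex) set \<Rightarrow> ('a \<Rightarrow> complex) \<Rightarrow> ('a \<Rightarrow> complex)" where
  "proj_subspace M H f = (SOME g. g \<in> H \<and> (\<forall>h\<in>H. l2_inner M (\<lambda>x. f x - g x) h = 0))"

text \<open>
  A partition \<open>{Y\<^sub>1, \<dots>, Y\<^sub>J}\<close> is an indexed family, so that repeated (null) members are allowed.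
\<close>

definition mu_partition :: "'a measure \<Rightarrow> nat \<Rightarrow> (nat \<Rightarrow> 'a set) \<Rightarrow> bool" where
  "mu_partition M J Y \<longleftrightarrow>
     (\<forall>j\<in>{1..J}. Y j \<in> sets M) \<and>
     measure M (space M - (\<Union>j\<in>{1..J}. Y j)) = 0 \<and>
     (\<forall>j\<in>{1..J}. \<forall>k\<in>{1..J}. j \<noteq> k \<longrightarrow> measure M (Y j \<inter> Y k) = 0)"

definition mu_sum ::
    "'a measure \<Rightarrow> nat \<Rightarrow> (nat \<Rightarrow> 'a set) \<Rightarrow> (('a \<Rightarrow> complex) \<Rightarrow> ('a \<Rightarrow> complex)) \<Rightarrow> real" where
  "mu_sum M J Y W = (\<Sum>j=1..J. measure M (Y j) * (l2_opnorm M (W \<circ> proj_set (Y j)))\<^sup>2)"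

definition mu_norm :: "'a measure \<Rightarrow> (('a \<Rightarrow> complex) \<Rightarrow> ('a \<Rightarrow> complex)) \<Rightarrow> real" where
  "mu_norm M W = Inf {sqrt (mu_sum M J Y W) | J Y. mu_partition M J Y}"

definition mu_dim :: "'a measure \<Rightarrow> ('a \<Rightarrow> complex) set \<Rightarrow> real" where
  "mu_dim M H = (mu_norm M (proj_subspace M H))\<^sup>2"

definition measure_automorphism :: "'a measure \<Rightarrow> ('a \<Rightarrow> 'a) \<Rightarrow> bool" where
  "measure_automorphism M F \<longleftrightarrow>
     bij_betw F (space M) (space M) \<and>
     F \<in> measurable M M \<and>
     the_inv_into (space M) F \<in> measurable M M \<and>
     (\<forall>X\<in>sets M. measure M (F -` X \<inter> space M) = measure M X)"

definition cyclic_action :: "'a measure \<Rightarrow> nat \<Rightarrow> (int \<Rightarrow> 'a \<Rightarrow> 'a) \<Rightarrow> bool" where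
  "cyclic_action M q F \<longleftrightarrow>
     (\<forall>s\<in>carrier (integer_mod_group q). measure_automorphism M (F s)) \<and>
     (\<forall>s\<in>carrier (integer_mod_group q). \<forall>t\<in>carrier (integer_mod_group q). \<forall>x\<in>space M.
        F s (F t x) = F (s \<otimes>\<^bsub>integer_mod_group q\<^esub> t) x) \<and>
     (\<forall>s\<in>carrier (integer_mod_group q). \<forall>x\<in>space M.
        F (inv\<^bsub>integer_mod_group q\<^esub> s) x = the_inv_into (space M) (F s) x)"

definition almost_free :: "'a measure \<Rightarrow> nat \<Rightarrow> (int \<Rightarrow> 'a \<Rightarrow> 'a) \<Rightarrow> bool" where
  "almost_free M q F \<longleftrightarrow>
     (\<exists>X\<in>sets M.
        disjoint_family_on (\<lambda>s. F s ` X) (carrier (integer_mod_group q)) \<and>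
        measure M (space M - (\<Union>s\<in>carrier (integer_mod_group q). F s ` X)) = 0)"

definition koopman :: "('a \<Rightarrow> 'a) \<Rightarrow> ('a \<Rightarrow> complex) \<Rightarrow> ('a \<Rightarrow> complex)" where
  "koopman T f = f \<circ> T"

definition root_unity :: "nat \<Rightarrow> complex" where
  "root_unity q = exp (2 * of_real pi * \<i> / of_nat q)"

definition eigenspace_H ::
    "'a measure \<Rightarrow> nat \<Rightarrow> (int \<Rightarrow> 'a \<Rightarrow> 'a) \<Rightarrow> int \<Rightarrow> ('a \<Rightarrow> complex) set" where
  "eigenspace_H M q F n =
     {f \<in> l2_space M. \<forall>s\<in>carrier (integer_mod_group q).
        aeq M (koopman (F s) f) (\<lambda>x. root_unity q powi (n * s) * f x)}"

end

theory Submission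
  imports Defs
begin

text \<open>
  The averages \<open>P n f = 1/q \<Sum>\<^sub>s r\<^sup>-\<^sup>n\<^sup>s U\<^sub>s f\<close> are the spectral projections of the action: they take values in
  \<open>H n\<close>, sum to the identity, and satisfy \<open>\<langle>P n f, h\<rangle> = \<langle>f, h\<rangle>\<close> for \<open>h \<in> H n\<close>. If \<open>f\<close> lives on one
  translate \<open>F\<^sub>s X\<close> of the fundamental domain, the functions \<open>U\<^sub>t f\<close> have disjoint supports, so
  \<open>\<parallel>P n f\<parallel>\<^sup>2 = \<langle>P n f, f\<rangle> = \<parallel>f\<parallel>\<^sup>2 / q\<close>. The partition into translates therefore gives \<open>\<M>\<^sub>\<chi> \<le> 1/q\<close>.
  Conversely every set of positive measure meets some translate in positive measure, so every
  operator norm in \<open>\<M>\<^sub>\<chi>\<close> has square at least \<open>1/q\<close>, and no partition does better.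
\<close>

section \<open>Square-integrable functions, their inner product and norm\<close>

lemma l2_space_measurable: "f \<in> l2_space M \<Longrightarrow> f \<in> borel_measurable M"
  by (simp add: l2_space_def)

lemma l2_space_integrable: "f \<in> l2_space M \<Longrightarrow> integrable M (\<lambda>x. (cmod (f x))\<^sup>2)"
  by (simp add: l2_space_def)

lemma l2_space_zero: "(\<lambda>x. 0) \<in> l2_space M"
  by (simp add: l2_space_def)

text \<open>The triangle inequality combined with (|a| - |b|)^2 \<ge> 0. This pointwise bound stands
  in for Minkowski's inequality: it gives closure of \<open>l2_space M\<close> under sums and a norm
  estimate good enough for limits.\<close>

lemma norm_add_square_le: "(cmod (a + b))\<^sup>2 \<le> 2 * (cmod a)\<^sup>2 + 2 * (cmod b)\<^sup>2"
proof -
  have "(cmod (a + b))\<^sup>2 \<le> (cmod a + cmod b)\<^sup>2"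
    by (intro power_mono norm_triangle_ineq) auto
  also have "\<dots> \<le> 2 * (cmod a)\<^sup>2 + 2 * (cmod b)\<^sup>2"
    using zero_le_power2[of "cmod a - cmod b"] by (simp add: power2_eq_square algebra_simps)
  finally show ?thesis .
qed

lemma l2_space_add:
  assumes "f \<in> l2_space M" "g \<in> l2_space M"
  shows "(\<lambda>x. f x + g x) \<in> l2_space M"
proof -
  have m: "f \<in> borel_measurable M" "g \<in> borel_measurable M"
    using assms by (auto simp: l2_space_def)
  have "integrable M (\<lambda>x. 2 * (cmod (f x))\<^sup>2 + 2 * (cmod (g x))\<^sup>2)"
    using assms by (auto simp: l2_space_def)
  then have "integrable M (\<lambda>x. (cmod (f x + g x))\<^sup>2)"
    by (rule Bochner_Integration.integrable_bound) (use m norm_add_square_le in auto)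
  with m show ?thesis by (simp add: l2_space_def)
qed

lemma l2_space_cmult: "f \<in> l2_space M \<Longrightarrow> (\<lambda>x. c * f x) \<in> l2_space M"
  by (auto simp: l2_space_def norm_mult power_mult_distrib)

lemma l2_space_diff:
  assumes "f \<in> l2_space M" "g \<in> l2_space M"
  shows "(\<lambda>x. f x - g x) \<in> l2_space M"
  using l2_space_add[OF assms(1) l2_space_cmult[OF assms(2), of "-1"]] by simp

lemma l2_space_sum:
  assumes "\<And>i. i \<in> I \<Longrightarrow> f i \<in> l2_space M"
  shows "(\<lambda>x. \<Sum>i\<in>I. f i x) \<in> l2_space M"
  using assms by (induction I rule: infinite_finite_induct) (auto intro: l2_space_zero l2_space_add)

lemma l2_space_proj_set:
  assumes "f \<in> l2_space M" "Y \<in> sets M"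
  shows "proj_set Y f \<in> l2_space M"
proof -
  have m: "f \<in> borel_measurable M"
    using assms by (auto simp: l2_space_def)
  have "integrable M (\<lambda>x. (cmod (proj_set Y f x))\<^sup>2)"
    by (rule Bochner_Integration.integrable_bound[OF l2_space_integrable[OF assms(1)]])
      (use m assms(2) in \<open>auto simp: proj_set_def indicator_def\<close>)
  with m assms(2) show ?thesis by (simp add: l2_space_def proj_set_def)
qed

text \<open>Arithmetic-geometric mean inequality. It replaces Cauchy-Schwarz, both for the
  integrability of products and for the contractivity of the averages \<open>P n\<close>.\<close>

lemma norm_mult_le_squares: "cmod (a * cnj b) \<le> ((cmod a)\<^sup>2 + (cmod b)\<^sup>2) / 2"
  using zero_le_power2[of "cmod a - cmod b"] by (simp add: norm_mult power2_eq_square algebra_simps)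

lemma borel_measurable_cnj [measurable]: "cnj \<in> borel_measurable borel"
  by (intro borel_measurable_continuous_onI continuous_intros)

lemma l2_inner_integrable:
  assumes "f \<in> l2_space M" "g \<in> l2_space M"
  shows "integrable M (\<lambda>x. f x * cnj (g x))"
proof -
  have m: "f \<in> borel_measurable M" "g \<in> borel_measurable M"
    using assms by (auto simp: l2_space_def)
  have "integrable M (\<lambda>x. ((cmod (f x))\<^sup>2 + (cmod (g x))\<^sup>2) / 2)"
    using assms by (auto simp: l2_space_def)
  then show ?thesis
    by (rule Bochner_Integration.integrable_bound)
      (use m norm_mult_le_squares in \<open>auto simp del: norm_mult\<close>)
qed

lemma l2_norm_nonneg: "0 \<le> l2_norm M f"
  by (simp add: l2_norm_def)

lemma l2_norm_square: "(l2_norm M f)\<^sup>2 = (\<integral>x. (cmod (f x))\<^sup>2 \<partial>M)"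
  by (simp add: l2_norm_def)

lemma l2_norm_zero: "l2_norm M (\<lambda>x. 0) = 0"
  by (simp add: l2_norm_def)

lemma l2_inner_self: "l2_inner M f f = of_real ((l2_norm M f)\<^sup>2)"
proof -
  have "l2_inner M f f = (\<integral>x. complex_of_real ((cmod (f x))\<^sup>2) \<partial>M)"
    unfolding l2_inner_def complex_norm_square ..
  then show ?thesis by (simp only: l2_norm_square integral_complex_of_real)
qed

lemma l2_inner_diff_left:
  assumes "f \<in> l2_space M" "g \<in> l2_space M" "h \<in> l2_space M"
  shows "l2_inner M (\<lambda>x. f x - g x) h = l2_inner M f h - l2_inner M g h"
  using assms by (simp add: l2_inner_def left_diff_distrib l2_inner_integrable)

lemma l2_norm_cong_AE:
  assumes "f \<in> borel_measurable M" "g \<in> borel_measurable M" "aeq M f g"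
  shows "l2_norm M f = l2_norm M g"
  unfolding l2_norm_def
  by (rule arg_cong[of _ _ sqrt], rule integral_cong_AE) (use assms in \<open>auto simp: aeq_def\<close>)

lemma l2_norm_proj_set_le:
  assumes "f \<in> l2_space M" "Y \<in> sets M"
  shows "l2_norm M (proj_set Y f) \<le> l2_norm M f"
  unfolding l2_norm_def
  by (intro real_sqrt_le_mono integral_mono l2_space_integrable l2_space_proj_set assms)
    (auto simp: proj_set_def indicator_def)

lemma l2_norm_eq_0_iff:
  assumes "f \<in> l2_space M"
  shows "l2_norm M f = 0 \<longleftrightarrow> aeq M f (\<lambda>x. 0)"
  using integral_nonneg_eq_0_iff_AE[OF l2_space_integrable[OF assms]]
  by (simp add: l2_norm_def aeq_def)

lemma l2_norm_add_square_le:
  assumes "f \<in> l2_space M" "g \<in> l2_space M"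
  shows "(l2_norm M (\<lambda>x. f x + g x))\<^sup>2 \<le> 2 * (l2_norm M f)\<^sup>2 + 2 * (l2_norm M g)\<^sup>2"
proof -
  have "(\<integral>x. (cmod (f x + g x))\<^sup>2 \<partial>M) \<le> (\<integral>x. 2 * (cmod (f x))\<^sup>2 + 2 * (cmod (g x))\<^sup>2 \<partial>M)"
    by (intro integral_mono norm_add_square_le l2_space_integrable l2_space_add assms
        Bochner_Integration.integrable_add integrable_mult_right)
  then show ?thesis
    using assms by (simp add: l2_norm_square l2_space_integrable)
qed

text \<open>Scaled indicators are the test functions for the lower bound on operator norms.\<close>

lemma l2_norm_indicator:
  assumes "Y \<in> sets M" "emeasure M Y < \<infinity>"
  shows "(\<lambda>x. of_real c * indicator Y x) \<in> l2_space M"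
    and "(l2_norm M (\<lambda>x. of_real c * indicator Y x))\<^sup>2 = c\<^sup>2 * measure M Y"
proof -
  have eq: "(\<lambda>x. (cmod (of_real c * indicator Y x))\<^sup>2) = (\<lambda>x. c\<^sup>2 * indicator Y x)"
    by (auto simp: indicator_def)
  show "(\<lambda>x. of_real c * indicator Y x) \<in> l2_space M"
    unfolding l2_space_def mem_Collect_eq eq using assms by simp
  show "(l2_norm M (\<lambda>x. of_real c * indicator Y x))\<^sup>2 = c\<^sup>2 * measure M Y"
    unfolding l2_norm_square eq using assms by simp
qed

section \<open>Orthogonal projections, operator norms and partitions\<close>

text \<open>The explicit candidate \<open>g\<close> shows that the choice in
  \<open>proj_subspace\<close> succeeds, so no general projection theorem is invoked. The chosen
  function and \<open>g\<close> differ by an element of \<open>H\<close> that is orthogonal to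
  \<open>H\<close>, hence to itself.\<close>

lemma proj_subspace_eqI:
  assumes H: "closed_l2_subspace M H" and f: "f \<in> l2_space M" and g: "g \<in> H"
    and ortho: "\<And>h. h \<in> H \<Longrightarrow> l2_inner M (\<lambda>x. f x - g x) h = 0"
  shows "proj_subspace M H f \<in> l2_space M" and "aeq M (proj_subspace M H f) g"
proof -
  define p where "p = proj_subspace M H f"
  have "p \<in> H \<and> (\<forall>h\<in>H. l2_inner M (\<lambda>x. f x - p x) h = 0)"
    unfolding p_def proj_subspace_def
    using someI_ex[of "\<lambda>g. g \<in> H \<and> (\<forall>h\<in>H. l2_inner M (\<lambda>x. f x - g x) h = 0)"] g ortho by blast
  then have pH: "p \<in> H" and po: "\<And>h. h \<in> H \<Longrightarrow> l2_inner M (\<lambda>x. f x - p x) h = 0"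
    by auto
  have sub: "H \<subseteq> l2_space M" using H by (simp add: closed_l2_subspace_def)
  have l2: "p \<in> l2_space M" "g \<in> l2_space M" using pH g sub by auto
  then show "proj_subspace M H f \<in> l2_space M" by (simp add: p_def)
  have add: "\<And>a b. a \<in> H \<Longrightarrow> b \<in> H \<Longrightarrow> (\<lambda>x. a x + b x) \<in> H"
    and scale: "\<And>c a. a \<in> H \<Longrightarrow> (\<lambda>x. c * a x) \<in> H"
    using H by (simp_all add: closed_l2_subspace_def)
  have "(\<lambda>x. p x + -1 * g x) \<in> H" by (rule add[OF pH scale[OF g]])
  then have d: "(\<lambda>x. p x - g x) \<in> H" by simp
  then have dl: "(\<lambda>x. p x - g x) \<in> l2_space M" using sub by auto
  have "l2_inner M (\<lambda>x. p x - g x) (\<lambda>x. p x - g x) = 0"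
    using po[OF d] ortho[OF d]
    unfolding l2_inner_diff_left[OF f l2(1) dl] l2_inner_diff_left[OF f l2(2) dl]
      l2_inner_diff_left[OF l2 dl] by simp
  then have "l2_norm M (\<lambda>x. p x - g x) = 0" by (simp add: l2_inner_self)
  then show "aeq M (proj_subspace M H f) g"
    using l2_norm_eq_0_iff[OF dl] by (simp add: aeq_def p_def)
qed

text \<open>The zero function makes the set under the supremum nonempty, so a real upper bound
  passes to \<open>Sup\<close>.\<close>

lemma l2_opnorm_le:
  assumes "\<And>f. f \<in> l2_space M \<Longrightarrow> l2_norm M f \<le> 1 \<Longrightarrow> l2_norm M (W f) \<le> c"
  shows "l2_opnorm M W \<le> c"
  unfolding l2_opnorm_def
proof (rule cSup_least)
  have "(\<lambda>x. 0) \<in> l2_space M \<and> l2_norm M (\<lambda>x. 0) \<le> 1"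
    by (simp add: l2_space_zero l2_norm_zero)
  then show "{l2_norm M (W f) |f. f \<in> l2_space M \<and> l2_norm M f \<le> 1} \<noteq> {}" by blast
qed (use assms in auto)

text \<open>The uniform bound \<open>c\<close> keeps the set bounded above; without it the real
  supremum would carry no information.\<close>

lemma l2_opnorm_ge:
  assumes "\<And>f. f \<in> l2_space M \<Longrightarrow> l2_norm M f \<le> 1 \<Longrightarrow> l2_norm M (W f) \<le> c"
    and "f \<in> l2_space M" "l2_norm M f \<le> 1"
  shows "l2_norm M (W f) \<le> l2_opnorm M W"
  unfolding l2_opnorm_def
  by (rule cSup_upper) (use assms in \<open>auto intro!: bdd_aboveI[of _ c]\<close>)

text \<open>The members cover a set of measure 1, and the measure is subadditive. The inequality is
  the direction that the lower bound on \<open>mu_sum\<close> uses.\<close>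

lemma (in prob_space) sum_measure_partition_ge_1:
  assumes "mu_partition M J Y"
  shows "1 \<le> (\<Sum>j=1..J. measure M (Y j))"
proof -
  have s: "Y ` {1..J} \<subseteq> sets M" and z: "prob (space M - (\<Union>j\<in>{1..J}. Y j)) = 0"
    using assms by (auto simp: mu_partition_def)
  have "prob (\<Union>j\<in>{1..J}. Y j) = 1"
    using z s by (subst (asm) prob_compl) auto
  with finite_measure_subadditive_finite[OF _ s] show ?thesis by simp
qed

section \<open>Powers of the root of unity\<close>

lemma root_unity_nonzero: "root_unity q \<noteq> 0"
  by (simp add: root_unity_def)

lemma cnj_root_unity: "cnj (root_unity q) = inverse (root_unity q)"
  by (simp add: root_unity_def exp_cnj flip: exp_minus)

lemma cnj_root_unity_powi: "cnj (root_unity q powi k) = root_unity q powi (- k)"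
  by (simp add: cnj_root_unity power_int_minus power_int_inverse)

lemma root_unity_powi: "root_unity q powi k = exp (2 * of_real pi * \<i> * of_int k / of_nat q)"
  by (simp add: root_unity_def exp_power_int mult_ac)

text \<open>The kernel of the complex exponential consists of the integer multiples of 2 pi
  i.\<close>

lemma root_unity_powi_eq_1_iff:
  assumes "q \<ge> 1"
  shows "root_unity q powi k = 1 \<longleftrightarrow> int q dvd k"
proof
  assume "root_unity q powi k = 1"
  then obtain n :: int where "2 * pi * of_int k / of_nat q = of_int (2 * n) * pi"
    unfolding root_unity_powi exp_eq_1 by auto
  then have "real_of_int k = of_int (n * int q)"
    using assms by (simp add: field_simps)
  then have "k = n * int q" by linarith
  then show "int q dvd k" by simp
next
  assume "int q dvd k"
  then obtain n where "k = int q * n" ..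
  then have "root_unity q powi k = exp (2 * of_int n * of_real pi * \<i>)"
    using assms unfolding root_unity_powi by (simp add: field_simps)
  also have "\<dots> = 1" by (auto simp: exp_eq_1)
  finally show "root_unity q powi k = 1" .
qed

text \<open>Exponents matter only modulo \<open>q\<close>. This reconciles integer arithmetic in
  exponents with the reduced representatives that index the action.\<close>

lemma root_unity_powi_cong:
  assumes "q \<ge> 1" "int q dvd j - k"
  shows "root_unity q powi j = root_unity q powi k"
proof -
  have "root_unity q powi ((j - k) + k) = root_unity q powi (j - k) * root_unity q powi k"
    by (rule power_int_add) (simp add: root_unity_nonzero)
  then show ?thesis using root_unity_powi_eq_1_iff[OF assms(1), of "j - k"] assms(2) by simp
qed

text \<open>Orthogonality of the characters of the cyclic group, as a geometric sum whose ratio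
  \<open>z\<close> satisfies \<open>z ^ q = 1\<close>.\<close>

lemma sum_root_unity_powi:
  assumes "q \<ge> 1"
  shows "(\<Sum>s\<in>{0..<int q}. root_unity q powi (k * s)) = (if int q dvd k then of_nat q else 0)"
proof -
  define z where "z = root_unity q powi k"
  have "{0..<int q} = int ` {..<q}"
    by (simp add: image_int_atLeastLessThan lessThan_atLeast0)
  then have "(\<Sum>s\<in>{0..<int q}. root_unity q powi (k * s)) = (\<Sum>i<q. z ^ i)"
    by (simp add: sum.reindex power_int_mult z_def)
  moreover have "z ^ q = 1"
    using root_unity_powi_eq_1_iff[OF assms, of "k * int q"] by (simp add: power_int_mult z_def)
  ultimately show ?thesis
    using root_unity_powi_eq_1_iff[OF assms, of k] geometric_sum[of z q]
    by (auto simp: z_def)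
qed

section \<open>The cyclic action on points, sets and functions\<close>

locale cyclic_koopman = prob_space M for M :: "'a measure" +
  fixes q :: nat and F :: "int \<Rightarrow> 'a \<Rightarrow> 'a"
  assumes q_ge_1: "q \<ge> 1" and action: "cyclic_action M q F"
begin

abbreviation Zq :: "int set" where "Zq \<equiv> {0..<int q}"

lemma carrier_eq: "carrier (integer_mod_group q) = Zq"
  using q_ge_1 by (simp add: carrier_integer_mod_group)

lemma mod_in_Zq: "k mod int q \<in> Zq"
  using q_ge_1 by simp

lemma dvd_diff_Zq_iff:
  assumes "m \<in> Zq" "n \<in> Zq"
  shows "int q dvd m - n \<longleftrightarrow> m = n"
  using assms by (simp flip: mod_eq_dvd_iff)

lemma zero_in_Zq: "0 \<in> Zq"
  using q_ge_1 by simp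

lemma automorphism: "s \<in> Zq \<Longrightarrow> measure_automorphism M (F s)"
  using action by (simp add: cyclic_action_def carrier_eq)

lemma F_measurable: "s \<in> Zq \<Longrightarrow> F s \<in> measurable M M"
  using automorphism by (simp add: measure_automorphism_def)

lemma F_space: "s \<in> Zq \<Longrightarrow> x \<in> space M \<Longrightarrow> F s x \<in> space M"
  using F_measurable measurable_space by metis

lemma F_bij: "s \<in> Zq \<Longrightarrow> bij_betw (F s) (space M) (space M)"
  using automorphism by (simp add: measure_automorphism_def)

lemma F_add:
  assumes "s \<in> Zq" "t \<in> Zq" "x \<in> space M"
  shows "F s (F t x) = F ((s + t) mod int q) x"
  using action assms q_ge_1 by (simp add: cyclic_action_def carrier_eq mult_integer_mod_group)

text \<open>\<open>F 0\<close> is idempotent by the group law and injective on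
  \<open>space M\<close>, hence the identity there.\<close>

lemma F_zero:
  assumes "x \<in> space M"
  shows "F 0 x = x"
proof -
  have "F 0 (F 0 x) = F 0 x" using F_add[OF zero_in_Zq zero_in_Zq assms] by simp
  then show ?thesis
    using F_bij[OF zero_in_Zq] assms F_space[OF zero_in_Zq assms]
    by (auto simp: bij_betw_def dest: inj_onD)
qed

text \<open>The image under \<open>F s\<close> is the preimage under the inverse map, which is
  measurable for an automorphism.\<close>

lemma F_image_sets:
  assumes "s \<in> Zq" "X \<in> sets M"
  shows "F s ` X \<in> sets M"
proof -
  have X: "X \<subseteq> space M" using assms(2) by (rule sets.sets_into_space)
  have inj: "inj_on (F s) (space M)" and im: "F s ` space M = space M"
    using F_bij[OF assms(1)] by (auto simp: bij_betw_def)
  have "F s ` X = the_inv_into (space M) (F s) -` X \<inter> space M"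
  proof (intro Set.set_eqI iffI)
    fix y assume "y \<in> F s ` X"
    then show "y \<in> the_inv_into (space M) (F s) -` X \<inter> space M"
      using X im by (auto simp: the_inv_into_f_f[OF inj])
  next
    fix y assume "y \<in> the_inv_into (space M) (F s) -` X \<inter> space M"
    then show "y \<in> F s ` X"
      using f_the_inv_into_f[OF inj, of y] im by (metis IntE image_eqI vimageE)
  qed
  also have "\<dots> \<in> sets M"
    using automorphism[OF assms(1)] assms(2)
    by (auto simp: measure_automorphism_def intro: measurable_sets)
  finally show ?thesis .
qed

text \<open>Invariance as an equation between measures, so that change of variables applies to
  integrals, integrability and null sets alike.\<close>

lemma distr_F:
  assumes "s \<in> Zq"
  shows "distr M M (F s) = M"
proof (rule measure_eqI)
  fix A assume "A \<in> sets (distr M M (F s))"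
  then show "emeasure (distr M M (F s)) A = emeasure M A"
    using automorphism[OF assms] F_measurable[OF assms]
    by (simp add: emeasure_distr emeasure_eq_measure measure_automorphism_def)
qed simp

lemma integral_F:
  fixes f :: "'a \<Rightarrow> 'b :: {banach, second_countable_topology}"
  assumes "s \<in> Zq" "f \<in> borel_measurable M"
  shows "(\<integral>x. f (F s x) \<partial>M) = (\<integral>x. f x \<partial>M)"
  using integral_distr[OF F_measurable[OF assms(1)] assms(2)] distr_F[OF assms(1)] by simp

lemma AE_F:
  assumes "s \<in> Zq" "AE x in M. P x"
  shows "AE x in M. P (F s x)"
  by (rule AE_distrD[OF F_measurable[OF assms(1)]]) (simp only: distr_F[OF assms(1)] assms(2))

lemma l2_space_F:
  assumes "s \<in> Zq" "f \<in> l2_space M"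
  shows "(\<lambda>x. f (F s x)) \<in> l2_space M"
proof -
  have m: "f \<in> borel_measurable M" using assms by (simp add: l2_space_def)
  have "integrable (distr M M (F s)) (\<lambda>x. (cmod (f x))\<^sup>2)"
    using assms distr_F l2_space_integrable by simp
  then have "integrable M (\<lambda>x. (cmod (f (F s x)))\<^sup>2)"
    using integrable_distr F_measurable[OF assms(1)] by blast
  then show ?thesis
    using measurable_compose[OF F_measurable[OF assms(1)] m] by (simp add: l2_space_def)
qed

lemma l2_norm_F:
  assumes "s \<in> Zq" "f \<in> l2_space M"
  shows "l2_norm M (\<lambda>x. f (F s x)) = l2_norm M f"
  using integral_F[OF assms(1), of "\<lambda>x. (cmod (f x))\<^sup>2"] l2_space_measurable[OF assms(2)]
  by (simp add: l2_norm_def)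

lemma l2_inner_F:
  assumes "s \<in> Zq" "f \<in> l2_space M" "g \<in> l2_space M"
  shows "l2_inner M (\<lambda>x. f (F s x)) (\<lambda>x. g (F s x)) = l2_inner M f g"
proof -
  have [measurable]: "f \<in> borel_measurable M" "g \<in> borel_measurable M"
    using assms by (auto simp: l2_space_def)
  show ?thesis
    unfolding l2_inner_def by (rule integral_F[OF assms(1), of "\<lambda>x. f x * cnj (g x)"]) measurable
qed

section \<open>Eigenspaces: closedness and orthogonality\<close>

abbreviation H :: "int \<Rightarrow> ('a \<Rightarrow> complex) set" where "H \<equiv> eigenspace_H M q F"

abbreviation r :: complex where "r \<equiv> root_unity q"

lemma H_iff:
  "f \<in> H n \<longleftrightarrow> f \<in> l2_space M \<and> (\<forall>s\<in>Zq. AE x in M. f (F s x) = r powi (n * s) * f x)"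
  unfolding eigenspace_H_def by (simp add: carrier_eq aeq_def koopman_def)

lemma H_l2: "f \<in> H n \<Longrightarrow> f \<in> l2_space M"
  by (simp add: H_iff)

lemma H_AE: "f \<in> H n \<Longrightarrow> s \<in> Zq \<Longrightarrow> AE x in M. f (F s x) = r powi (n * s) * f x"
  by (simp add: H_iff)

text \<open>For limits, the defect \<open>e\<close> of the eigenvalue equation for \<open>f\<close>
  is controlled by the distance from \<open>f\<close> to \<open>u k\<close>, because composition
  with \<open>F s\<close> and multiplication by a root of unity both preserve the norm.\<close>

lemma closed_H: "closed_l2_subspace M (H n)"
  unfolding closed_l2_subspace_def
proof (intro conjI ballI allI impI)
  show "H n \<subseteq> l2_space M" using H_l2 by blast
  show "(\<lambda>x. 0) \<in> H n" by (simp add: H_iff l2_space_zero)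
  fix f g assume f: "f \<in> H n" and g: "g \<in> H n"
  have "AE x in M. f (F s x) + g (F s x) = r powi (n * s) * (f x + g x)" if "s \<in> Zq" for s
    using H_AE[OF f that] H_AE[OF g that] by eventually_elim (simp add: algebra_simps)
  with f g show "(\<lambda>x. f x + g x) \<in> H n" by (simp add: H_iff l2_space_add)
next
  fix c f assume f: "f \<in> H n"
  have "AE x in M. c * f (F s x) = r powi (n * s) * (c * f x)" if "s \<in> Zq" for s
    using H_AE[OF f that] by eventually_elim simp
  with f show "(\<lambda>x. c * f x) \<in> H n" by (simp add: H_iff l2_space_cmult)
next
  fix u f assume f: "f \<in> l2_space M" and u: "\<forall>k::nat. u k \<in> H n"
    and lim: "(\<lambda>k. l2_norm M (\<lambda>x. u k x - f x)) \<longlonglongrightarrow> 0"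
  have "AE x in M. f (F s x) = r powi (n * s) * f x" if s: "s \<in> Zq" for s
  proof -
    define c where "c = r powi (n * s)"
    have c1: "cmod c = 1" by (simp add: c_def root_unity_def norm_power_int)
    define d where "d k x = u k x - f x" for k x
    have ul: "u k \<in> l2_space M" for k using u H_l2 by blast
    then have dl: "d k \<in> l2_space M" for k unfolding d_def using f by (intro l2_space_diff)
    define e where "e x = f (F s x) - c * f x" for x
    have el: "e \<in> l2_space M" unfolding e_def
      by (intro l2_space_diff l2_space_F l2_space_cmult f s)
    have "(l2_norm M e)\<^sup>2 \<le> 4 * (l2_norm M (d k))\<^sup>2" for k
    proof -
      have l: "(\<lambda>x. - 1 * d k (F s x)) \<in> l2_space M" "(\<lambda>x. c * d k x) \<in> l2_space M"
        by (intro l2_space_cmult l2_space_F s dl)+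
      \<comment> \<open>The eigenvalue equation of \<open>u k\<close> cancels, leaving only two
        terms in the error \<open>d k\<close>. Both have the norm of \<open>d k\<close>, which
        explains the factor 4.\<close>
      have "aeq M e (\<lambda>x. - 1 * d k (F s x) + c * d k x)"
        using H_AE[OF u[rule_format, of k] s] unfolding aeq_def
        by eventually_elim (simp add: e_def d_def c_def algebra_simps)
      then have "l2_norm M e = l2_norm M (\<lambda>x. - 1 * d k (F s x) + c * d k x)"
        by (intro l2_norm_cong_AE l2_space_measurable l2_space_add l el)
      moreover have "l2_norm M (\<lambda>x. - 1 * d k (F s x)) = l2_norm M (d k)"
        using l2_norm_F[OF s dl[of k]] by (simp add: l2_norm_def)
      moreover have "l2_norm M (\<lambda>x. c * d k x) = l2_norm M (d k)"
        by (simp add: l2_norm_def norm_mult c1)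
      ultimately show ?thesis using l2_norm_add_square_le[OF l] by simp
    qed
    moreover have "(\<lambda>k. 4 * (l2_norm M (d k))\<^sup>2) \<longlonglongrightarrow> 4 * 0\<^sup>2"
      using lim unfolding d_def by (intro tendsto_intros)
    ultimately have "(l2_norm M e)\<^sup>2 \<le> 4 * 0\<^sup>2"
      using LIMSEQ_le_const by blast
    then have "aeq M e (\<lambda>x. 0)" using l2_norm_eq_0_iff[OF el] by simp
    then show ?thesis by (simp add: aeq_def e_def c_def)
  qed
  with f show "f \<in> H n" by (simp add: H_iff)
qed

text \<open>Applying the generator \<open>F 1\<close> leaves the inner product unchanged but also
  multiplies it by \<open>r powi (n - m)\<close>, which differs from 1.\<close>

lemma H_orthogonal:
  assumes "n \<in> Zq" "m \<in> Zq" "n \<noteq> m"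
  shows "l2_orthogonal M (H n) (H m)"
  unfolding l2_orthogonal_def
proof (intro ballI)
  fix f g assume f: "f \<in> H n" and g: "g \<in> H m"
  \<comment> \<open>Two distinct residues force \<open>q\<close> to be at least 2.\<close>
  have s: "1 \<in> Zq" using assms by auto
  have "l2_inner M f g = l2_inner M (\<lambda>x. f (F 1 x)) (\<lambda>x. g (F 1 x))"
    by (rule l2_inner_F[symmetric]) (use f g s H_l2 in auto)
  also have "\<dots> = (\<integral>x. r powi (n - m) * (f x * cnj (g x)) \<partial>M)"
    unfolding l2_inner_def
  proof (rule integral_cong_AE)
    show "AE x in M. f (F 1 x) * cnj (g (F 1 x)) = r powi (n - m) * (f x * cnj (g x))"
      using H_AE[OF f s] H_AE[OF g s]
    proof eventually_elim
      case (elim x)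
      have "r powi (n - m) = r powi n * cnj (r powi m)"
        unfolding cnj_root_unity_powi
        by (simp add: root_unity_nonzero flip: power_int_add)
      then show ?case using elim by simp
    qed
    have [measurable]: "f \<in> borel_measurable M" "g \<in> borel_measurable M" "F 1 \<in> measurable M M"
      using f g H_l2 l2_space_measurable F_measurable[OF s] by auto
    show "(\<lambda>x. f (F 1 x) * cnj (g (F 1 x))) \<in> borel_measurable M"
      "(\<lambda>x. r powi (n - m) * (f x * cnj (g x))) \<in> borel_measurable M" by measurable
  qed
  also have "\<dots> = r powi (n - m) * l2_inner M f g"
    by (simp add: l2_inner_def)
  finally have "r powi (n - m) = 1 \<or> l2_inner M f g = 0" by auto
  moreover have "\<not> int q dvd n - m" using assms dvd_diff_Zq_iff by blast
  ultimately show "l2_inner M f g = 0" using root_unity_powi_eq_1_iff[OF q_ge_1] by blast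
qed

section \<open>The averages as orthogonal projections onto the eigenspaces\<close>

text \<open>A pointwise formula on representatives, so that \<open>P_F\<close> and
  \<open>sum_P\<close> hold at every point of \<open>space M\<close> and not merely almost
  everywhere.\<close>

definition P :: "int \<Rightarrow> ('a \<Rightarrow> complex) \<Rightarrow> 'a \<Rightarrow> complex" where
  "P n f x = (\<Sum>s\<in>Zq. r powi (- (n * s)) * f (F s x)) / of_nat q"

lemma P_l2:
  assumes "f \<in> l2_space M"
  shows "P n f \<in> l2_space M"
proof -
  have "(\<lambda>x. (1 / of_nat q) * (\<Sum>s\<in>Zq. r powi (- (n * s)) * f (F s x))) \<in> l2_space M"
    by (intro l2_space_cmult l2_space_sum l2_space_F assms)
  moreover have "P n f = (\<lambda>x. (1 / of_nat q) * (\<Sum>s\<in>Zq. r powi (- (n * s)) * f (F s x)))"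
    by (simp add: P_def fun_eq_iff)
  ultimately show ?thesis by simp
qed

text \<open>Translation by \<open>t\<close> permutes the summands; the sum is reindexed by
  \<open>s + t\<close> modulo \<open>q\<close>.\<close>

lemma P_F:
  assumes t: "t \<in> Zq" and x: "x \<in> space M"
  shows "P n f (F t x) = r powi (n * t) * P n f x"
proof -
  have "(\<Sum>s\<in>Zq. r powi (- (n * s)) * f (F s (F t x))) =
      (\<Sum>s\<in>Zq. r powi (n * t) * (r powi (- (n * s)) * f (F s x)))"
  proof (rule sum.reindex_bij_witness[where i = "\<lambda>s. (s - t) mod int q" and j = "\<lambda>s. (s + t) mod int q"])
    fix s assume s: "s \<in> Zq"
    show "((s + t) mod int q - t) mod int q = s" "((s - t) mod int q + t) mod int q = s"
      using s by (simp_all add: mod_simps)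
    show "(s + t) mod int q \<in> Zq" "(s - t) mod int q \<in> Zq" by (rule mod_in_Zq)+
    \<comment> \<open>Reducing \<open>s + t\<close> modulo \<open>q\<close> changes the exponent by
      a multiple of \<open>q\<close>, which the root of unity does not see.\<close>
    have "int q dvd n * (s + t - (s + t) mod int q)"
      by (intro dvd_mult dvd_minus_mod)
    then have "r powi (n * t + - (n * ((s + t) mod int q))) = r powi (- (n * s))"
      by (intro root_unity_powi_cong q_ge_1) (simp add: algebra_simps)
    then show "r powi (n * t) * (r powi (- (n * ((s + t) mod int q))) * f (F ((s + t) mod int q) x))
        = r powi (- (n * s)) * f (F s (F t x))"
      using s t x by (simp add: F_add root_unity_nonzero flip: power_int_add mult.assoc)
  qed
  then show ?thesis by (simp add: P_def flip: sum_distrib_left)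
qed

lemma P_in_H:
  assumes "f \<in> l2_space M"
  shows "P n f \<in> H n"
  unfolding H_iff using P_l2[OF assms] P_F by (auto intro!: AE_I2)

text \<open>After exchanging the sums, character orthogonality kills every term except
  \<open>s = 0\<close>, where \<open>F 0\<close> is the identity.\<close>

lemma sum_P:
  assumes x: "x \<in> space M"
  shows "(\<Sum>n\<in>Zq. P n f x) = f x"
proof -
  have dvd: "int q dvd s \<longleftrightarrow> s = 0" if "s \<in> Zq" for s
    using dvd_diff_Zq_iff[OF that zero_in_Zq] by simp
  have "(\<Sum>n\<in>Zq. P n f x) = (\<Sum>s\<in>Zq. \<Sum>n\<in>Zq. r powi (- s * n) * f (F s x)) / of_nat q"
    unfolding P_def by (subst sum.swap) (simp add: mult.commute flip: sum_divide_distrib)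
  also have "(\<Sum>s\<in>Zq. \<Sum>n\<in>Zq. r powi (- s * n) * f (F s x)) =
      (\<Sum>s\<in>Zq. (if s = 0 then of_nat q else 0) * f (F s x))"
    unfolding sum_distrib_right[symmetric] sum_root_unity_powi[OF q_ge_1]
    by (intro sum.cong refl) (simp add: dvd)
  also have "\<dots> = (\<Sum>s\<in>Zq. if s = 0 then of_nat q * f x else 0)"
    by (intro sum.cong refl) (auto simp: F_zero[OF x])
  also have "\<dots> / of_nat q = f x"
    using q_ge_1 by simp
  finally show ?thesis .
qed

text \<open>On \<open>H m\<close> each summand carries the factor
  \<open>r powi ((m - n) * s)\<close>, so character orthogonality applies. This gives uniqueness of
  decompositions.\<close>

lemma P_of_H:
  assumes f: "f \<in> H m" and "n \<in> Zq" "m \<in> Zq"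
  shows "AE x in M. P n f x = (if n = m then f x else 0)"
proof -
  have dvd: "int q dvd m - n \<longleftrightarrow> n = m"
    using assms dvd_diff_Zq_iff by blast
  have "AE x in M. \<forall>s\<in>Zq. f (F s x) = r powi (m * s) * f x"
    using H_AE[OF f] by (intro AE_finite_allI) auto
  then show ?thesis
  proof eventually_elim
    case (elim x)
    have "(\<Sum>s\<in>Zq. r powi (- (n * s)) * f (F s x)) = (\<Sum>s\<in>Zq. r powi ((m - n) * s) * f x)"
      by (intro sum.cong refl)
        (use elim in \<open>simp add: root_unity_nonzero algebra_simps flip: power_int_add\<close>)
    also have "\<dots> = (if n = m then of_nat q * f x else 0)"
      unfolding sum_distrib_right[symmetric] sum_root_unity_powi[OF q_ge_1] dvd by simp
    finally show ?case using q_ge_1 by (simp add: P_def)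
  qed
qed

text \<open>The averages of \<open>f\<close> form a decomposition; applying \<open>P n\<close> to
  any other decomposition recovers its component of index \<open>n\<close>.\<close>

lemma l2_direct_sum_H: "l2_direct_sum M Zq H"
  unfolding l2_direct_sum_def
proof (intro conjI ballI)
  show "closed_l2_subspace M (H n)" for n by (rule closed_H)
  fix f assume f: "f \<in> l2_space M"
  show "\<exists>g. (\<forall>n\<in>Zq. g n \<in> H n) \<and> aeq M f (\<lambda>x. \<Sum>n\<in>Zq. g n x) \<and>
        (\<forall>g'. (\<forall>n\<in>Zq. g' n \<in> H n) \<and> aeq M f (\<lambda>x. \<Sum>n\<in>Zq. g' n x) \<longrightarrow>
           (\<forall>n\<in>Zq. aeq M (g' n) (g n)))"
  proof (intro exI[of _ "\<lambda>n. P n f"] conjI ballI allI impI)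
    show "P n f \<in> H n" for n by (rule P_in_H[OF f])
    show "aeq M f (\<lambda>x. \<Sum>n\<in>Zq. P n f x)" by (auto simp: aeq_def sum_P intro!: AE_I2)
    fix g n assume g: "(\<forall>n\<in>Zq. g n \<in> H n) \<and> aeq M f (\<lambda>x. \<Sum>n\<in>Zq. g n x)" and n: "n \<in> Zq"
    \<comment> \<open>Evaluating \<open>P n f\<close> at \<open>x\<close> involves all translates of
      \<open>x\<close>, so the almost-everywhere identity is needed along the whole finite
      orbit.\<close>
    have "AE x in M. \<forall>s\<in>Zq. f (F s x) = (\<Sum>m\<in>Zq. g m (F s x))"
      using g by (intro AE_finite_allI AE_F[where P = "\<lambda>x. f x = (\<Sum>m\<in>Zq. g m x)"]) (auto simp: aeq_def)
    moreover have "AE x in M. \<forall>m\<in>Zq. P n (g m) x = (if n = m then g m x else 0)"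
      using g n by (intro AE_finite_allI P_of_H) auto
    ultimately show "aeq M (g n) (P n f)"
      unfolding aeq_def
    proof eventually_elim
      case (elim x)
      have "P n f x = (\<Sum>s\<in>Zq. \<Sum>m\<in>Zq. r powi (- (n * s)) * g m (F s x)) / of_nat q"
        using elim(1) by (simp add: P_def sum_distrib_left)
      also have "\<dots> = (\<Sum>m\<in>Zq. P n (g m) x)"
        by (subst sum.swap) (simp add: P_def flip: sum_divide_distrib)
      also have "\<dots> = (\<Sum>m\<in>Zq. if n = m then g m x else 0)"
        using elim(2) by (intro sum.cong) auto
      also have "\<dots> = g n x" using n by simp
      finally show ?case by simp
    qed
  qed
qed

text \<open>Every summand contributes the same value: the factor \<open>r powi (- (n * s))\<close>
  turns \<open>cnj (h x)\<close> into \<open>cnj (h (F s x))\<close>, and \<open>F s\<close>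
  preserves the inner product.\<close>

lemma l2_inner_P:
  assumes f: "f \<in> l2_space M" and h: "h \<in> H n"
  shows "l2_inner M (P n f) h = l2_inner M f h"
proof -
  have hl: "h \<in> l2_space M" using h by (rule H_l2)
  have integral_term: "(\<integral>x. r powi (- (n * s)) * f (F s x) * cnj (h x) \<partial>M) = l2_inner M f h"
    if s: "s \<in> Zq" for s
  proof -
    have [measurable]: "f \<in> borel_measurable M" "h \<in> borel_measurable M" "F s \<in> measurable M M"
      using f hl l2_space_measurable F_measurable[OF s] by auto
    have "(\<integral>x. r powi (- (n * s)) * f (F s x) * cnj (h x) \<partial>M) =
        l2_inner M (\<lambda>x. f (F s x)) (\<lambda>x. h (F s x))"
      unfolding l2_inner_def
    proof (rule integral_cong_AE)
      show "AE x in M. r powi (- (n * s)) * f (F s x) * cnj (h x) = f (F s x) * cnj (h (F s x))"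
        using H_AE[OF h s] by eventually_elim (simp add: cnj_root_unity_powi del: complex_cnj_power_int)
    qed measurable
    then show ?thesis using l2_inner_F[OF s f hl] by simp
  qed
  have "l2_inner M (P n f) h =
      (\<integral>x. (\<Sum>s\<in>Zq. r powi (- (n * s)) * f (F s x) * cnj (h x)) / of_nat q \<partial>M)"
    by (simp add: l2_inner_def P_def sum_distrib_right)
  also have "\<dots> = (\<Sum>s\<in>Zq. \<integral>x. r powi (- (n * s)) * f (F s x) * cnj (h x) \<partial>M) / of_nat q"
    by (subst integral_divide_zero, subst Bochner_Integration.integral_sum)
      (use l2_inner_integrable[OF l2_space_cmult[OF l2_space_F[OF _ f]] hl] in auto)
  also have "\<dots> = l2_inner M f h"
    using q_ge_1 by (simp add: integral_term)
  finally show ?thesis .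
qed

text \<open>The residual \<open>f - P n f\<close> is orthogonal to \<open>H n\<close> by
  \<open>l2_inner_P\<close>. Comparing norms avoids the ambiguity of \<open>proj_subspace\<close> on
  null sets.\<close>

lemma proj_H:
  assumes "f \<in> l2_space M"
  shows "l2_norm M (proj_subspace M (H n) f) = l2_norm M (P n f)"
proof -
  have "l2_inner M (\<lambda>x. f x - P n f x) h = 0" if "h \<in> H n" for h
    using that assms by (simp add: l2_inner_diff_left P_l2 H_l2 l2_inner_P)
  from proj_subspace_eqI[OF closed_H assms P_in_H[OF assms] this]
  show ?thesis
    by (intro l2_norm_cong_AE) (use assms P_l2 in \<open>auto intro: l2_space_measurable\<close>)
qed

text \<open>\<open>l2_inner_P\<close> with \<open>h = P n f\<close>, followed by conjugate
  symmetry.\<close>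

lemma l2_norm_P_inner:
  assumes "f \<in> l2_space M"
  shows "complex_of_real ((l2_norm M (P n f))\<^sup>2) = cnj (l2_inner M (P n f) f)"
proof -
  have "complex_of_real ((l2_norm M (P n f))\<^sup>2) = l2_inner M f (P n f)"
    using l2_inner_P[OF assms P_in_H[OF assms]] by (simp add: l2_inner_self)
  also have "\<dots> = cnj (l2_inner M (P n f) f)"
    unfolding l2_inner_def by (simp add: mult.commute flip: Bochner_Integration.integral_cnj)
  finally show ?thesis .
qed

text \<open>The squared norm of \<open>P n f\<close> is at most half the sum of the squared norms of
  \<open>P n f\<close> and \<open>f\<close>; half of the left side is then absorbed.\<close>

lemma l2_norm_P_le:
  assumes f: "f \<in> l2_space M"
  shows "l2_norm M (P n f) \<le> l2_norm M f"
proof -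
  have Pl: "P n f \<in> l2_space M" by (rule P_l2[OF f])
  have "(l2_norm M (P n f))\<^sup>2 = cmod (l2_inner M (P n f) f)"
    using arg_cong[OF l2_norm_P_inner[OF f, of n], of cmod] by (simp add: norm_power)
  also have "\<dots> \<le> (\<integral>x. cmod (P n f x * cnj (f x)) \<partial>M)"
    unfolding l2_inner_def by (rule integral_norm_bound)
  also have "\<dots> \<le> (\<integral>x. ((cmod (P n f x))\<^sup>2 + (cmod (f x))\<^sup>2) / 2 \<partial>M)"
    by (intro integral_mono norm_mult_le_squares integrable_norm l2_inner_integrable Pl f
        integrable_divide Bochner_Integration.integrable_add l2_space_integrable)
  also have "\<dots> = ((l2_norm M (P n f))\<^sup>2 + (l2_norm M f)\<^sup>2) / 2"
    using Pl f by (simp add: l2_norm_square l2_space_integrable)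
  finally have "(l2_norm M (P n f))\<^sup>2 \<le> (l2_norm M f)\<^sup>2" by simp
  then show ?thesis using l2_norm_nonneg by (rule power2_le_imp_le)
qed

text \<open>In the integrand of the inner product of \<open>P n f\<close> with \<open>f\<close> only
  the summand \<open>s = 0\<close> survives.\<close>

lemma l2_norm_P_wandering:
  assumes f: "f \<in> l2_space M"
    and wandering: "\<And>t x. t \<in> Zq \<Longrightarrow> t \<noteq> 0 \<Longrightarrow> x \<in> space M \<Longrightarrow> f (F t x) * cnj (f x) = 0"
  shows "(l2_norm M (P n f))\<^sup>2 = (l2_norm M f)\<^sup>2 / q"
proof -
  have "l2_inner M (P n f) f = (\<integral>x. f x * cnj (f x) / of_nat q \<partial>M)"
    unfolding l2_inner_def
  proof (rule Bochner_Integration.integral_cong)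
    fix x assume x: "x \<in> space M"
    have "P n f x * cnj (f x) = (\<Sum>s\<in>Zq. r powi (- (n * s)) * (f (F s x) * cnj (f x))) / of_nat q"
      by (simp add: P_def sum_distrib_right mult.assoc)
    also have "(\<Sum>s\<in>Zq. r powi (- (n * s)) * (f (F s x) * cnj (f x))) =
        (\<Sum>s\<in>Zq. if s = 0 then f x * cnj (f x) else 0)"
      by (intro sum.cong refl) (auto simp: F_zero[OF x] wandering[OF _ _ x] simp del: mult_eq_0_iff)
    also have "\<dots> = f x * cnj (f x)" using q_ge_1 by simp
    finally show "P n f x * cnj (f x) = f x * cnj (f x) / of_nat q" .
  qed simp
  also have "\<dots> = of_real ((l2_norm M f)\<^sup>2 / q)"
    using l2_inner_self[of M f] by (simp add: l2_inner_def)
  finally show ?thesis using l2_norm_P_inner[OF f, of n] by (metis complex_cnj_complex_of_real of_real_eq_iff)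
qed

section \<open>The fundamental domain and the mu-dimension\<close>

context
  fixes X
  assumes X: "X \<in> sets M" and disj: "disjoint_family_on (\<lambda>s. F s ` X) Zq"
begin

text \<open>\<open>F t\<close> carries the translate indexed by \<open>s\<close> into the one
  indexed by \<open>(t + s) mod int q\<close>, a different index because \<open>t\<close> is a
  nonzero residue.\<close>

lemma translate_disjoint:
  assumes s: "s \<in> Zq" and t: "t \<in> Zq" "t \<noteq> 0" and x: "x \<in> F s ` X"
  shows "F t x \<notin> F s ` X"
proof
  assume y: "F t x \<in> F s ` X"
  obtain z where z: "z \<in> X" "x = F s z" using x by auto
  have zs: "z \<in> space M" using z X sets.sets_into_space by auto
  have "F t x = F ((t + s) mod int q) z" using z F_add[OF t(1) s zs] by simp
  then have "F t x \<in> F ((t + s) mod int q) ` X" using z by auto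
  moreover have "(t + s) mod int q \<noteq> s"
  proof
    assume "(t + s) mod int q = s"
    then have "(t + s) mod int q = s mod int q" using s by simp
    then have "int q dvd t" by (simp add: mod_eq_dvd_iff)
    then show False using t dvd_diff_Zq_iff[OF t(1) zero_in_Zq] by simp
  qed
  ultimately show False
    using y disj s mod_in_Zq[of "t + s"] unfolding disjoint_family_on_def by blast
qed

lemma l2_norm_P_translate:
  assumes f: "f \<in> l2_space M" and s: "s \<in> Zq" and supp: "\<And>x. x \<notin> F s ` X \<Longrightarrow> f x = 0"
  shows "(l2_norm M (P n f))\<^sup>2 = (l2_norm M f)\<^sup>2 / q"
proof (rule l2_norm_P_wandering[OF f])
  show "f (F t x) * cnj (f x) = 0" if "t \<in> Zq" "t \<noteq> 0" for t x
    using translate_disjoint[OF s that] supp by (cases "x \<in> F s ` X") auto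
qed

lemma opnorm_translate_le:
  assumes s: "s \<in> Zq"
  shows "(l2_opnorm M (proj_subspace M (H n) \<circ> proj_set (F s ` X)))\<^sup>2 \<le> 1 / q"
proof -
  let ?W = "proj_subspace M (H n) \<circ> proj_set (F s ` X)"
  have Y: "F s ` X \<in> sets M" by (rule F_image_sets[OF s X])
  have le: "l2_norm M (?W f) \<le> sqrt (1 / q)" if f: "f \<in> l2_space M" "l2_norm M f \<le> 1" for f
  proof (rule real_le_rsqrt)
    let ?g = "proj_set (F s ` X) f"
    have g: "?g \<in> l2_space M" by (rule l2_space_proj_set[OF f(1) Y])
    have "(l2_norm M (?W f))\<^sup>2 = (l2_norm M (P n ?g))\<^sup>2" using proj_H[OF g] by simp
    also have "\<dots> = (l2_norm M ?g)\<^sup>2 / q"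
      by (rule l2_norm_P_translate[OF g s]) (simp add: proj_set_def)
    also have "(l2_norm M ?g)\<^sup>2 \<le> 1\<^sup>2"
      using l2_norm_proj_set_le[OF f(1) Y] f(2) by (intro power_mono l2_norm_nonneg) simp
    finally show "(l2_norm M (?W f))\<^sup>2 \<le> 1 / q" by (simp add: divide_right_mono)
  qed
  have "l2_opnorm M ?W \<le> sqrt (1 / q)" by (rule l2_opnorm_le[OF le])
  \<comment> \<open>Squaring the bound needs a nonnegative supremum; the norm of the image of the
    zero function lies below it.\<close>
  moreover have "0 \<le> l2_opnorm M ?W"
    using l2_norm_nonneg l2_opnorm_ge[where W = ?W, OF le l2_space_zero] l2_norm_zero[of M]
    by (metis order_trans zero_le_one)
  ultimately have "(l2_opnorm M ?W)\<^sup>2 \<le> (sqrt (1 / q))\<^sup>2" by (intro power_mono)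
  then show ?thesis by simp
qed

text \<open>Some translate meets \<open>Y\<close> in positive measure. The normalised indicator of
  that intersection is fixed by \<open>proj_set Y\<close> and has a projection of squared norm
  exactly \<open>1 / q\<close>.\<close>

lemma opnorm_ge:
  assumes cover: "measure M (space M - (\<Union>s\<in>Zq. F s ` X)) = 0"
    and Y: "Y \<in> sets M" and pos: "measure M Y > 0"
  shows "1 / q \<le> (l2_opnorm M (proj_subspace M (H n) \<circ> proj_set Y))\<^sup>2"
proof -
  let ?W = "proj_subspace M (H n) \<circ> proj_set Y"
  \<comment> \<open>Needed only to make the supremum bounded above.\<close>
  have le: "l2_norm M (?W f) \<le> 1" if f: "f \<in> l2_space M" "l2_norm M f \<le> 1" for f
    using proj_H[OF l2_space_proj_set[OF f(1) Y]] l2_norm_P_le[OF l2_space_proj_set[OF f(1) Y]]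
      l2_norm_proj_set_le[OF f(1) Y] f(2) by (metis comp_apply order_trans)
  have FX: "F s ` X \<in> sets M" if "s \<in> Zq" for s by (rule F_image_sets[OF that X])
  \<comment> \<open>Otherwise \<open>Y\<close> would be covered by finitely many null sets together
    with the null complement of the translates.\<close>
  have "\<exists>s\<in>Zq. prob (Y \<inter> F s ` X) > 0"
  proof (rule ccontr)
    assume "\<not> (\<exists>s\<in>Zq. prob (Y \<inter> F s ` X) > 0)"
    then have z: "prob (Y \<inter> F s ` X) = 0" if "s \<in> Zq" for s
      using that measure_nonneg[of M "Y \<inter> F s ` X"] by (meson antisym_conv not_less)
    have "prob Y \<le> prob ((space M - (\<Union>s\<in>Zq. F s ` X)) \<union> (\<Union>s\<in>Zq. Y \<inter> F s ` X))"
      using sets.sets_into_space[OF Y] Y FX by (intro finite_measure_mono) auto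
    also have "\<dots> \<le> prob (space M - (\<Union>s\<in>Zq. F s ` X)) + prob (\<Union>s\<in>Zq. Y \<inter> F s ` X)"
      using Y FX by (intro measure_Un_le) auto
    also have "prob (\<Union>s\<in>Zq. Y \<inter> F s ` X) \<le> (\<Sum>s\<in>Zq. prob (Y \<inter> F s ` X))"
      using Y FX by (intro finite_measure_subadditive_finite) auto
    finally show False using pos cover z by simp
  qed
  then obtain s where s: "s \<in> Zq" and pA: "prob (Y \<inter> F s ` X) > 0" by blast
  define A where "A = Y \<inter> F s ` X"
  \<comment> \<open>Chosen so that \<open>c\<^sup>2 * prob A = 1\<close>, which gives the test
    function norm 1.\<close>
  define c where "c = 1 / sqrt (prob A)"
  define f :: "'a \<Rightarrow> complex" where "f x = of_real c * indicator A x" for x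
  have A: "A \<in> sets M" unfolding A_def using Y FX[OF s] by auto
  have fl: "f \<in> l2_space M" and fn: "(l2_norm M f)\<^sup>2 = 1"
    using l2_norm_indicator[OF A, of c] pA
    by (auto simp: f_def[abs_def] c_def A_def power_divide emeasure_eq_measure)
  have pf: "proj_set Y f = f"
    by (auto simp: proj_set_def f_def A_def indicator_def)
  have n1: "l2_norm M f = 1" using fn l2_norm_nonneg[of M f] by (simp add: power2_eq_1_iff)
  have "1 / q = (l2_norm M (P n f))\<^sup>2"
    using l2_norm_P_translate[OF fl s, of n] fn by (simp add: f_def A_def)
  also have "\<dots> = (l2_norm M (?W f))\<^sup>2" using proj_H[OF fl] pf by simp
  also have "\<dots> \<le> (l2_opnorm M ?W)\<^sup>2"
    using l2_opnorm_ge[where W = ?W, OF le fl] n1 by (intro power_mono l2_norm_nonneg) auto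
  finally show ?thesis .
qed

text \<open>The value \<open>1 / q\<close> bounds every \<open>mu_sum\<close> from below and is
  attained by the partition into translates, so the infimum is a minimum.\<close>

lemma mu_dim_H:
  assumes cover: "measure M (space M - (\<Union>s\<in>Zq. F s ` X)) = 0"
  shows "mu_dim M (H n) = 1 / q"
proof -
  let ?S = "{sqrt (mu_sum M J Y (proj_subspace M (H n))) | J Y. mu_partition M J Y}"
  have lower: "1 / q \<le> mu_sum M J Y (proj_subspace M (H n))" if part: "mu_partition M J Y" for J Y
  proof -
    have "1 / q \<le> (\<Sum>j=1..J. measure M (Y j)) * (1 / q)"
      using mult_right_mono[OF sum_measure_partition_ge_1[OF part], of "1 / q"] by simp
    also have "\<dots> = (\<Sum>j=1..J. measure M (Y j) * (1 / q))" by (rule sum_distrib_right)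
    also have "\<dots> \<le> mu_sum M J Y (proj_subspace M (H n))"
      unfolding mu_sum_def
    proof (rule sum_mono)
      fix j assume "j \<in> {1..J}"
      then have "Y j \<in> sets M" using part by (auto simp: mu_partition_def)
      \<comment> \<open>Null members give 0 on both sides; \<open>opnorm_ge\<close> handles those of
        positive measure.\<close>
      then show "measure M (Y j) * (1 / q) \<le>
          measure M (Y j) * (l2_opnorm M (proj_subspace M (H n) \<circ> proj_set (Y j)))\<^sup>2"
        using opnorm_ge[OF cover, of "Y j" n]
        by (cases "measure M (Y j) = 0")
          (auto intro!: mult_left_mono simp: zero_less_measure_iff simp del: mult_1_right times_divide_eq_right)
    qed
    finally show ?thesis .
  qed
  \<comment> \<open>Partitions are indexed from 1 and residues from 0, hence the shift.\<close>
  define Y where "Y j = F (int j - 1) ` X" for j :: nat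
  have mem: "int j - 1 \<in> Zq" if "j \<in> {1..q}" for j using that by auto
  have Ysets: "Y j \<in> sets M" if "j \<in> {1..q}" for j
    unfolding Y_def by (rule F_image_sets[OF mem[OF that] X])
  have Ydisj: "disjoint_family_on Y {1..q}"
    unfolding disjoint_family_on_def
  proof (intro ballI impI)
    fix j k assume jk: "j \<in> {1..q}" "k \<in> {1..q}" "j \<noteq> k"
    then have "int j - 1 \<noteq> int k - 1" by simp
    then show "Y j \<inter> Y k = {}"
      using disj mem[OF jk(1)] mem[OF jk(2)] unfolding disjoint_family_on_def Y_def by blast
  qed
  have Zq_im: "Zq = (\<lambda>j. int j - 1) ` {1..q}"
  proof (intro equalityI subsetI)
    fix s assume "s \<in> Zq"
    then have "s = int (nat (s + 1)) - 1" "nat (s + 1) \<in> {1..q}" by auto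
    then show "s \<in> (\<lambda>j. int j - 1) ` {1..q}" by blast
  qed auto
  have YU: "(\<Union>j\<in>{1..q}. Y j) = (\<Union>s\<in>Zq. F s ` X)"
    unfolding Zq_im Y_def by auto
  have part: "mu_partition M q Y"
    unfolding mu_partition_def YU
    using Ysets cover Ydisj by (auto simp: disjoint_family_on_def)
  have "mu_sum M q Y (proj_subspace M (H n)) \<le> (\<Sum>j=1..q. measure M (Y j) * (1 / q))"
    unfolding mu_sum_def Y_def
    by (intro sum_mono mult_left_mono opnorm_translate_le mem) auto
  also have "\<dots> = measure M (\<Union>j\<in>{1..q}. Y j) * (1 / q)"
    using finite_measure_finite_Union[of "{1..q}" Y] Ysets Ydisj
    by (simp add: image_subset_iff sum_divide_distrib)
  also have "\<dots> \<le> 1 * (1 / q)" by (intro mult_right_mono prob_le_1) simp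
  finally have "mu_sum M q Y (proj_subspace M (H n)) = 1 / q"
    using lower[OF part] by simp
  then have "sqrt (1 / q) \<in> ?S" using part by force
  then have "mu_norm M (proj_subspace M (H n)) = sqrt (1 / q)"
    unfolding mu_norm_def using lower by (intro cInf_eq_minimum) (auto intro!: real_sqrt_le_mono)
  then show ?thesis by (simp add: mu_dim_def)
qed

end

end

theorem lemma3p5:
  fixes M :: "'a measure" and q :: nat and F :: "int \<Rightarrow> 'a \<Rightarrow> 'a"
  assumes "prob_space M"
    and "q \<ge> 1"
    and "cyclic_action M q F"
    and "almost_free M q F"
  shows "(\<forall>n\<in>carrier (integer_mod_group q). \<forall>m\<in>carrier (integer_mod_group q). n \<noteq> m \<longrightarrow>
            l2_orthogonal M (eigenspace_H M q F n) (eigenspace_H M q F m)) \<and>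
         l2_direct_sum M (carrier (integer_mod_group q)) (eigenspace_H M q F) \<and>
         (\<forall>n\<in>carrier (integer_mod_group q). mu_dim M (eigenspace_H M q F n) = 1 / real q)"
proof -
  interpret prob_space M by fact
  interpret cyclic_koopman M q F by unfold_locales fact+
  obtain X where "X \<in> sets M" "disjoint_family_on (\<lambda>s. F s ` X) Zq"
    "measure M (space M - (\<Union>s\<in>Zq. F s ` X)) = 0"
    using assms(4) unfolding almost_free_def carrier_eq by blast
  then show ?thesis
    unfolding carrier_eq using H_orthogonal l2_direct_sum_H mu_dim_H by blast
qed

end
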